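(* Let $X$ be a topological space that has a $\pi$-tree, and let $F\subseteq X$ be $\sigma$-compact. Then the subspace $Y=X\setminus F$ of $X$ also has a $\pi$-tree.
   Context: A tree is a pair $\mathcal T=(Q,<)$ where $<$ is an irreflexive transitive relation on $Q$ such that for every $x\in Q$ the set $\{v\in Q:v<x\}$ is well-ordered by $<$; $Q$ is its set of nodes. Write $x\le y$ for ($x<y$ or $x=y$). $\mathrm{sons}(x)=\{s: x<s$ and there is no $v$ with $x<v<s\}$. A chain is a set of pairwise comparable nodes; a branch is an inclusion-maximal chain. A foliage tree is a pair $\mathbf F=(\mathcal T,l)$ with $\mathcal T$ a tree (the skeleton of $\mathbf F$) and $l$ a function with domain the nodes of $\mathcal T$; $\mathbf F_x:=l(x)$ is the leaf at node $x$; tree notions for $\mathbf F$ mean those of its skeleton. For a nonempty set $A$ of nodes, $\mathrm{fruit}_{\mathbf F}(A)=\bigcap_{x\in A}\mathbf F_x$. $\mathrm{shoot}_{\mathbf F}(z)=\{\bigcup_{s\in C}\mathbf F_s: C$ is a cofinite subset of $\mathrm{sons}(z)\}$; $\mathrm{scope}_{\mathbf F}(p)=\{y:p\in\mathbf F_y\}$. For families $\gamma,\delta$ of sets, $\gamma\gg\delta$ means: for every nonempty $D\in\delta$ there is a nonempty $G\in\gamma$ with $G\subseteq D$. $\mathbf F$ is locally strict if for every non-maximal node $x$, $\mathbf F_x$ is the union of the pairwise disjoint family $(\mathbf F_s)_{s\in\mathrm{sons}(x)}$; $\mathbf F$ has strict branches if it has at least one node and $\mathrm{fruit}_{\mathbf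 F}(B)$ is a singleton for every branch $B$; $\mathbf F$ is open in a space $X$ if every leaf is open in $X$; $\mathbf F$ is a foliage $\omega,\aleph_0$-tree if its skeleton is isomorphic to $(\omega^{<\omega},\subsetneq)$ (finite sequences of naturals ordered by proper extension). A Baire foliage tree on a space $X$ is a foliage $\omega,\aleph_0$-tree that is open in $X$, locally strict, has strict branches, and whose leaf at its least node equals $X$. $\mathbf F$ grows into $X$ if for every $p\in X$ and every (not necessarily open) neighbourhood $U$ of $p$ in $X$ there is $z\in\mathrm{scope}_{\mathbf F}(p)$ with $\mathrm{shoot}_{\mathbf F}(z)\gg\{U\}$. A $\pi$-tree on $X$ is a Baire foliage tree on $X$ that grows into $X$; $X$ has a $\pi$-tree if some foliage tree is a $\pi$-tree on $X$. (Equivalently, $X$ has a Lusin $\pi$-base.) *)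

theory Defs
  imports "HOL-Analysis.Analysis" "HOL-Library.Sublist"
begin

definition is_tree :: "'n set \<Rightarrow> ('n \<Rightarrow> 'n \<Rightarrow> bool) \<Rightarrow> bool" where
  "is_tree Q lt \<longleftrightarrow>
     (\<forall>x y. lt x y \<longrightarrow> x \<in> Q \<and> y \<in> Q) \<and>
     (\<forall>x\<in>Q. \<not> lt x x) \<and>
     (\<forall>x\<in>Q. \<forall>y\<in>Q. \<forall>z\<in>Q. lt x y \<and> lt y z \<longrightarrow> lt x z) \<and>
     (\<forall>x\<in>Q. let P = {v\<in>Q. lt v x} in
        (\<forall>a\<in>P. \<forall>b\<in>P. a \<noteq> b \<longrightarrow> lt a b \<or> lt b a) \<and>
        (\<forall>S. S \<subseteq> P \<and> S \<noteq> {} \<longrightarrow> (\<exists>m\<in>S. \<forall>s\<in>S. \<not> lt s m)))"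

definition sons :: "'n set \<Rightarrow> ('n \<Rightarrow> 'n \<Rightarrow> bool) \<Rightarrow> 'n \<Rightarrow> 'n set" where
  "sons Q lt x = {s\<in>Q. lt x s \<and> \<not> (\<exists>v\<in>Q. lt x v \<and> lt v s)}"

definition is_chain :: "'n set \<Rightarrow> ('n \<Rightarrow> 'n \<Rightarrow> bool) \<Rightarrow> 'n set \<Rightarrow> bool" where
  "is_chain Q lt C \<longleftrightarrow> C \<subseteq> Q \<and> (\<forall>x\<in>C. \<forall>y\<in>C. x \<noteq> y \<longrightarrow> lt x y \<or> lt y x)"

definition is_branch :: "'n set \<Rightarrow> ('n \<Rightarrow> 'n \<Rightarrow> bool) \<Rightarrow> 'n set \<Rightarrow> bool" where
  "is_branch Q lt B \<longleftrightarrow> is_chain Q lt B \<and> (\<forall>C. is_chain Q lt C \<and> B \<subseteq> C \<longrightarrow> C = B)"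

definition fruit :: "('n \<Rightarrow> 'a set) \<Rightarrow> 'n set \<Rightarrow> 'a set" where
  "fruit l A = (\<Inter>x\<in>A. l x)"

definition shoot :: "'n set \<Rightarrow> ('n \<Rightarrow> 'n \<Rightarrow> bool) \<Rightarrow> ('n \<Rightarrow> 'a set) \<Rightarrow> 'n \<Rightarrow> 'a set set" where
  "shoot Q lt l z = {(\<Union>s\<in>C. l s) | C. C \<subseteq> sons Q lt z \<and> finite (sons Q lt z - C)}"

definition scope :: "'n set \<Rightarrow> ('n \<Rightarrow> 'a set) \<Rightarrow> 'a \<Rightarrow> 'n set" where
  "scope Q l p = {y\<in>Q. p \<in> l y}"

definition refines :: "'a set set \<Rightarrow> 'a set set \<Rightarrow> bool" where
  "refines \<gamma> \<delta> \<longleftrightarrow> (\<forall>D\<in>\<delta>. D \<noteq> {} \<longrightarrow> (\<exists>G\<in>\<gamma>. G \<noteq> {} \<and> G \<subseteq> D))"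

definition locally_strict :: "'n set \<Rightarrow> ('n \<Rightarrow> 'n \<Rightarrow> bool) \<Rightarrow> ('n \<Rightarrow> 'a set) \<Rightarrow> bool" where
  "locally_strict Q lt l \<longleftrightarrow>
     (\<forall>x\<in>Q. (\<exists>y\<in>Q. lt x y) \<longrightarrow>
        l x = (\<Union>s\<in>sons Q lt x. l s) \<and>
        (\<forall>s\<in>sons Q lt x. \<forall>t\<in>sons Q lt x. s \<noteq> t \<longrightarrow> l s \<inter> l t = {}))"

definition strict_branches :: "'n set \<Rightarrow> ('n \<Rightarrow> 'n \<Rightarrow> bool) \<Rightarrow> ('n \<Rightarrow> 'a set) \<Rightarrow> bool" where
  "strict_branches Q lt l \<longleftrightarrow>
     Q \<noteq> {} \<and> (\<forall>B. is_branch Q lt B \<longrightarrow> (\<exists>p. fruit l B = {p}))"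

definition foliage_open_in :: "'a topology \<Rightarrow> 'n set \<Rightarrow> ('n \<Rightarrow> 'a set) \<Rightarrow> bool" where
  "foliage_open_in X Q l \<longleftrightarrow> (\<forall>x\<in>Q. openin X (l x))"

definition omega_tree :: "'n set \<Rightarrow> ('n \<Rightarrow> 'n \<Rightarrow> bool) \<Rightarrow> bool" where
  "omega_tree Q lt \<longleftrightarrow>
     (\<exists>f. bij_betw f Q (UNIV :: nat list set) \<and>
          (\<forall>x\<in>Q. \<forall>y\<in>Q. lt x y \<longleftrightarrow> strict_prefix (f x) (f y)))"

definition baire_foliage_tree :: "'a topology \<Rightarrow> 'n set \<Rightarrow> ('n \<Rightarrow> 'n \<Rightarrow> bool) \<Rightarrow> ('n \<Rightarrow> 'a set) \<Rightarrow> bool" where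
  "baire_foliage_tree X Q lt l \<longleftrightarrow>
     is_tree Q lt \<and> omega_tree Q lt \<and> foliage_open_in X Q l \<and> locally_strict Q lt l \<and>
     strict_branches Q lt l \<and>
     (\<exists>r\<in>Q. (\<forall>x\<in>Q. x \<noteq> r \<longrightarrow> lt r x) \<and> l r = topspace X)"

definition grows_into :: "'a topology \<Rightarrow> 'n set \<Rightarrow> ('n \<Rightarrow> 'n \<Rightarrow> bool) \<Rightarrow> ('n \<Rightarrow> 'a set) \<Rightarrow> bool" where
  "grows_into X Q lt l \<longleftrightarrow>
     (\<forall>p\<in>topspace X. \<forall>U. U \<subseteq> topspace X \<and> (\<exists>V. openin X V \<and> p \<in> V \<and> V \<subseteq> U) \<longrightarrow>
        (\<exists>z\<in>scope Q l p. refines (shoot Q lt l z) {U}))"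

definition pi_tree :: "'a topology \<Rightarrow> 'n set \<Rightarrow> ('n \<Rightarrow> 'n \<Rightarrow> bool) \<Rightarrow> ('n \<Rightarrow> 'a set) \<Rightarrow> bool" where
  "pi_tree X Q lt l \<longleftrightarrow> baire_foliage_tree X Q lt l \<and> grows_into X Q lt l"

text \<open>Nodes of a foliage omega,aleph_0-tree form a countable set, so any such tree can be
  transported to one whose nodes are natural-number lists; hence the node type is fixed.\<close>
definition has_pi_tree :: "'a topology \<Rightarrow> bool" where
  "has_pi_tree X \<longleftrightarrow> (\<exists>(Q :: nat list set) lt l. pi_tree X Q lt l)"

definition sigma_compact_in :: "'a topology \<Rightarrow> 'a set \<Rightarrow> bool" where
  "sigma_compact_in X F \<longleftrightarrow> (\<exists>K :: nat \<Rightarrow> 'a set. (\<forall>n. compactin X (K n)) \<and> F = (\<Union>n. K n))"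

end

theory Submission
  imports Defs
begin

text \<open>
  Index the leaves of the given tree by finite sequences, so that the children of \<open>s\<close> are the
  \<open>s @ [k]\<close>, and let \<open>K\<close> be one of the compact sets. The nodes \<open>t\<close> whose leaf \<open>L t\<close> meets \<open>K\<close> form
  a finitely branching tree, and every point of \<open>L s - K\<close> leaves this tree at a unique exit.
  The exits are coloured by natural numbers so that a node at height \<open>h\<close> above \<open>s\<close> has infinitely
  many exits of each colour \<open>m \<ge> h\<close> and none of a smaller colour. In the new tree \<open>L s - F\<close> is first
  split according to colour. For a fixed colour \<open>m\<close> one then descends the old tree, going
  through at most \<open>m + 1\<close> levels before an exit is reached and the next compact set is treated.
  Hence no branch runs into \<open>F\<close>. Moreover, a point whose branch in the old tree passes through \<open>t\<close>
  lies in a leaf of the new tree whose sons are contained in distinct sets \<open>L (t @ [k])\<close>, so the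
  growth condition at \<open>t\<close> is inherited.
\<close>

section \<open>Finite sequences under the prefix order\<close>

lemma chain_limit:
  assumes "\<And>\<sigma> \<tau>. \<sigma> \<in> B \<Longrightarrow> \<tau> \<in> B \<Longrightarrow> prefix \<sigma> \<tau> \<or> prefix \<tau> \<sigma>"
    and "\<And>n. \<exists>\<sigma>\<in>B. n < length \<sigma>"
  obtains \<beta> where "\<And>\<sigma>. \<sigma> \<in> B \<Longrightarrow> \<sigma> = map \<beta> [0..<length \<sigma>]"
proof -
  obtain c where c: "\<And>n. c n \<in> B" "\<And>n. n < length (c n)"
    using assms(2) by metis
  \<comment> \<open>Entry \<open>n\<close> of the limit is read off from a member longer than
    \<open>n\<close>; comparability makes the choice of that member irrelevant.\<close>
  have "\<sigma> = map (\<lambda>n. c n ! n) [0..<length \<sigma>]" if \<sigma>: "\<sigma> \<in> B" for \<sigma>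
  proof (rule nth_equalityI)
    fix i assume i: "i < length \<sigma>"
    have "\<sigma> ! i = c i ! i"
      using assms(1)[OF \<sigma> c(1)[of i]] i c(2)[of i] by (auto simp: prefix_def nth_append)
    then show "\<sigma> ! i = map (\<lambda>n. c n ! n) [0..<length \<sigma>] ! i"
      using i by simp
  qed simp
  then show thesis by (rule that)
qed

lemma prefix_map_upt: "prefix (map \<alpha> [0..<m]) (map \<alpha> [0..<n]) \<longleftrightarrow> m \<le> n"
proof
  assume "prefix (map \<alpha> [0..<m]) (map \<alpha> [0..<n])"
  then show "m \<le> n" using prefix_length_le by fastforce
next
  assume "m \<le> n"
  then have "[0..<n] = [0..<m] @ [m..<n]"
    using upt_add_eq_append[of 0 m "n - m"] by simp
  then show "prefix (map \<alpha> [0..<m]) (map \<alpha> [0..<n])"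
    by simp
qed

lemma prefix_same_length: "prefix s t \<Longrightarrow> length s = length t \<Longrightarrow> s = t"
  by (auto simp: prefix_def)

section \<open>Schemes of open sets indexed by finite sequences\<close>

text \<open>A pi-tree in normal form: the skeleton is all of \<open>nat list\<close>, and the sons
  of \<open>s\<close> are the \<open>s @ [k]\<close>. \<open>grow\<close> unfolds the condition on
  shoots: cofinitely many sons lie in \<open>V\<close>. Their union is then nonempty, because
  \<open>branch\<close> makes every leaf nonempty.\<close>

locale pi_scheme =
  fixes X :: "'a topology" and L :: "nat list \<Rightarrow> 'a set"
  assumes root: "L [] = topspace X"
    and split: "L s = (\<Union>k. L (s @ [k]))"
    and disj: "i \<noteq> j \<Longrightarrow> L (s @ [i]) \<inter> L (s @ [j]) = {}"
    and open_L: "openin X (L s)"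
    and branch: "\<exists>p. (\<Inter>n. L (map \<alpha> [0..<n])) = {p}"
    and grow: "openin X V \<Longrightarrow> p \<in> V \<Longrightarrow> \<exists>s. p \<in> L s \<and> finite {k. \<not> L (s @ [k]) \<subseteq> V}"
begin

lemma L_mono: "prefix s t \<Longrightarrow> L t \<subseteq> L s"
proof -
  have "L (s @ u) \<subseteq> L s" for u
  proof (induction u rule: rev_induct)
    case (snoc k u)
    then show ?case using split[of "s @ u"] by auto
  qed simp
  then show "prefix s t \<Longrightarrow> L t \<subseteq> L s" by (auto simp: prefix_def)
qed

text \<open>Incomparable nodes pass through two different sons of a common node, and these have
  disjoint leaves.\<close>

lemma comparable:
  assumes "p \<in> L s" "p \<in> L t"
  shows "prefix s t \<or> prefix t s"
proof (rule ccontr)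
  assume "\<not> ?thesis"
  then have "s \<parallel> t" by auto
  then obtain as b bs c cs where eq: "b \<noteq> c" "s = as @ b # bs" "t = as @ c # cs"
    using parallel_decomp by blast
  then have "L s \<subseteq> L (as @ [b])" "L t \<subseteq> L (as @ [c])"
    by (auto intro!: L_mono)
  then show False using disj[OF eq(1)] assms by blast
qed

lemma ex_level: "p \<in> topspace X \<Longrightarrow> \<exists>s. length s = n \<and> p \<in> L s"
proof (induction n)
  case 0
  then show ?case by (simp add: root)
next
  case (Suc n)
  then obtain s where "length s = n" "p \<in> L s" by blast
  then obtain k where "p \<in> L (s @ [k])" using split by blast
  then show ?case using \<open>length s = n\<close> by (intro exI[of _ "s @ [k]"]) auto
qed

lemma L_nonempty: "L s \<noteq> {}"
proof -
  \<comment> \<open>Any infinite branch through \<open>s\<close> will do; here \<open>s\<close> is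
    continued by zeros.\<close>
  define \<alpha> where "\<alpha> i = (if i < length s then s ! i else 0)" for i
  have "map \<alpha> [0..<length s] = s"
    by (rule nth_equalityI) (auto simp: \<alpha>_def)
  then show ?thesis using branch[of \<alpha>] by (metis INT_E empty_iff insertI1 UNIV_I)
qed

text \<open>Otherwise \<open>p\<close> would lie in every leaf containing \<open>q\<close>, and the
  fruit of the branch of \<open>q\<close> would contain both points.\<close>

lemma separate:
  assumes "p \<in> topspace X" "q \<in> topspace X" "p \<noteq> q"
  shows "\<exists>u. q \<in> L u \<and> p \<notin> L u"
proof (rule ccontr)
  assume no: "\<not> ?thesis"
  obtain \<beta> where \<beta>: "\<And>u. u \<in> {u. q \<in> L u} \<Longrightarrow> u = map \<beta> [0..<length u]"
  proof (rule chain_limit[of "{u. q \<in> L u}"])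
    show "\<exists>\<sigma>\<in>{u. q \<in> L u}. n < length \<sigma>" for n
      using ex_level[OF assms(2), of "Suc n"] by force
  qed (use comparable in auto)
  have "q \<in> L (map \<beta> [0..<n])" for n
    using ex_level[OF assms(2), of n] \<beta> by force
  moreover from this have "p \<in> L (map \<beta> [0..<n])" for n
    using no by blast
  ultimately have "{p, q} \<subseteq> (\<Inter>n. L (map \<beta> [0..<n]))" by simp
  then show False using branch[of \<beta>] assms(3) by (metis insert_subset singletonD)
qed

text \<open>The leaves of one level form an open partition of the space, so a compact set meets only
  finitely many of them.\<close>

lemma compact_finitely_branching:
  assumes "compactin X K"
  shows "finite {k. L (t @ [k]) \<inter> K \<noteq> {}}"
proof -
  let ?U = "{u. length u = Suc (length t)}"
  have "K \<subseteq> \<Union> (L ` ?U)"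
    using ex_level[of _ "Suc (length t)"] compactin_subset_topspace[OF assms] by blast
  then obtain \<F> where \<F>: "finite \<F>" "\<F> \<subseteq> L ` ?U" "K \<subseteq> \<Union>\<F>"
    using compactinD[OF assms, of "L ` ?U"] open_L by auto
  have "L (t @ [k]) \<in> \<F>" if k: "L (t @ [k]) \<inter> K \<noteq> {}" for k
  proof -
    obtain q where "q \<in> L (t @ [k])" "q \<in> K" using k by blast
    moreover from this obtain D where "D \<in> \<F>" "q \<in> D" using \<F>(3) by blast
    moreover from this obtain u where "D = L u" "length u = Suc (length t)" using \<F>(2) by blast
    ultimately have q: "q \<in> L (t @ [k])" "L u \<in> \<F>" "q \<in> L u" "length u = Suc (length t)"
      by simp_all
    then have "u = t @ [k]"
      using comparable[OF q(1,3)] prefix_same_length by (metis length_append_singleton)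
    then show ?thesis using q by simp
  qed
  then have "(\<lambda>k. L (t @ [k])) ` {k. L (t @ [k]) \<inter> K \<noteq> {}} \<subseteq> \<F>" by blast
  moreover have "inj (\<lambda>k. L (t @ [k]))"
    using disj L_nonempty by (metis (no_types, lifting) Int_absorb injI)
  ultimately show ?thesis
    using \<F>(1) by (meson finite_imageD finite_subset inj_on_subset subset_UNIV)
qed

text \<open>By \<open>separate\<close>, finitely many leaves avoiding \<open>p\<close> cover
  \<open>K\<close>. A leaf around \<open>p\<close> at least as deep as all of these cannot meet one
  of them, since it would then be contained in it.\<close>

lemma compact_escape:
  assumes K: "compactin X K" and p: "p \<in> topspace X" "p \<notin> K"
  shows "\<exists>n. \<forall>u. p \<in> L u \<and> n \<le> length u \<longrightarrow> L u \<inter> K = {}"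
proof -
  let ?U = "{u. p \<notin> L u}"
  have "K \<subseteq> \<Union> (L ` ?U)"
    using separate[OF p(1)] p(2) compactin_subset_topspace[OF K] by blast
  then obtain \<F> where \<F>: "finite \<F>" "\<F> \<subseteq> L ` ?U" "K \<subseteq> \<Union>\<F>"
    using compactinD[OF K, of "L ` ?U"] open_L by auto
  then obtain C where C: "C \<subseteq> ?U" "finite C" "\<F> = L ` C"
    using finite_subset_image[OF \<F>(1,2)] by blast
  \<comment> \<open>The inserted \<open>0\<close> keeps the maximum defined when the cover is
    empty.\<close>
  have "L u \<inter> K = {}" if u: "p \<in> L u" "Max (insert 0 (length ` C)) \<le> length u" for u
  proof (rule ccontr)
    assume "L u \<inter> K \<noteq> {}"
    then obtain q c where q: "q \<in> L u" "q \<in> L c" "c \<in> C" using \<F>(3) C(3) by blast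
    have "length c \<le> length u" using u(2) C(2) q(3) by simp
    then have "prefix c u"
      using comparable[OF q(1,2)] by (metis prefix_length_le prefix_same_length le_antisym)
    then show False using L_mono u(1) C(1) q(3) by blast
  qed
  then show ?thesis by blast
qed

end

section \<open>Schemes versus foliage trees\<close>

lemma sons_list: "sons UNIV strict_prefix (s :: nat list) = range (\<lambda>k. s @ [k])"
proof
  show "sons UNIV strict_prefix s \<subseteq> range (\<lambda>k. s @ [k])"
  proof
    fix t assume t: "t \<in> sons UNIV strict_prefix s"
    then obtain k u where "t = s @ k # u"
      by (auto simp: sons_def elim: strict_prefixE')
    moreover have "u = []"
    proof (rule ccontr)
      assume "u \<noteq> []"
      then have "strict_prefix s (s @ [k])" "strict_prefix (s @ [k]) t"
        using \<open>t = s @ k # u\<close> by (auto simp: strict_prefix_def prefix_def)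
      then show False using t by (auto simp: sons_def)
    qed
    ultimately show "t \<in> range (\<lambda>k. s @ [k])" by simp
  qed
  show "range (\<lambda>k. s @ [k]) \<subseteq> sons UNIV strict_prefix s"
    by (auto simp: sons_def strict_prefix_def)
qed

lemma branch_of_sequence:
  "is_branch UNIV strict_prefix (range (\<lambda>n. map \<alpha> [0..<n]) :: nat list set)"
  unfolding is_branch_def
proof (intro conjI allI impI)
  show "is_chain UNIV strict_prefix (range (\<lambda>n. map \<alpha> [0..<n]))"
    by (auto simp: is_chain_def strict_prefix_def prefix_map_upt)
next
  fix C assume C: "is_chain UNIV strict_prefix C \<and> range (\<lambda>n. map \<alpha> [0..<n]) \<subseteq> C"
  have "c \<in> range (\<lambda>n. map \<alpha> [0..<n])" if c: "c \<in> C" for c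
  proof -
    let ?m = "map \<alpha> [0..<length c]"
    have "?m \<in> C" using C by blast
    then have "prefix c ?m \<or> prefix ?m c"
      using C c unfolding is_chain_def strict_prefix_def by (metis prefix_order.order_refl)
    then have "c = ?m" using prefix_same_length by (metis length_map length_upt minus_nat.diff_0)
    then show ?thesis by blast
  qed
  then show "C = range (\<lambda>n. map \<alpha> [0..<n])" using C by blast
qed

text \<open>A chain of bounded length consists of prefixes of a single \<open>\<tau>\<close> and
  could be enlarged by \<open>\<tau> @ [0]\<close>. Hence a maximal chain is unbounded and lies
  along its limit sequence.\<close>

lemma branch_list:
  assumes B: "is_branch UNIV strict_prefix (B :: nat list set)"
  obtains \<alpha> where "B = range (\<lambda>n. map \<alpha> [0..<n])"
proof -
  have chain: "prefix \<sigma> \<tau> \<or> prefix \<tau> \<sigma>" if "\<sigma> \<in> B" "\<tau> \<in> B" for \<sigma> \<tau>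
    using B that unfolding is_branch_def is_chain_def strict_prefix_def
    by (metis prefix_order.order_refl)
  have max: "C = B" if "is_chain UNIV strict_prefix C" "B \<subseteq> C" for C
    using B that unfolding is_branch_def by blast
  have unb: "\<exists>\<sigma>\<in>B. n < length \<sigma>" for n
  proof (rule ccontr)
    assume "\<not> ?thesis"
    then have bd: "\<And>\<sigma>. \<sigma> \<in> B \<Longrightarrow> length \<sigma> \<le> n" by force
    obtain \<tau> where \<tau>: "\<And>\<sigma>. \<sigma> \<in> B \<Longrightarrow> prefix \<sigma> \<tau>"
    proof (cases "B = {}")
      case False
      then obtain \<tau> where "\<tau> \<in> B" "\<And>\<sigma>. \<sigma> \<in> B \<Longrightarrow> length \<sigma> \<le> length \<tau>"
        using ex_has_greatest_nat[of "\<lambda>\<sigma>. \<sigma> \<in> B" _ length "Suc n"] bd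
        by (metis equals0I le_imp_less_Suc)
      then show thesis
        using that chain by (metis prefix_length_le prefix_same_length le_antisym)
    qed (use that in blast)
    have pre: "prefix \<sigma> (\<tau> @ [0])" if "\<sigma> \<in> B" for \<sigma>
      using \<tau>[OF that] by (rule prefix_prefix)
    have "is_chain UNIV strict_prefix (insert (\<tau> @ [0]) B)"
      using pre chain by (auto simp: is_chain_def strict_prefix_def)
    then have "\<tau> @ [0] \<in> B" using max by blast
    then show False using \<tau>[of "\<tau> @ [0]"] prefix_length_le by fastforce
  qed
  obtain \<alpha> where \<alpha>: "\<And>\<sigma>. \<sigma> \<in> B \<Longrightarrow> \<sigma> = map \<alpha> [0..<length \<sigma>]"
    using chain_limit[OF chain unb] by metis
  then have "B \<subseteq> range (\<lambda>n. map \<alpha> [0..<n])" by blast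
  then have "B = range (\<lambda>n. map \<alpha> [0..<n])"
    using max branch_of_sequence unfolding is_branch_def by metis
  then show thesis by (rule that)
qed

lemma is_tree_list: "is_tree UNIV (strict_prefix :: nat list \<Rightarrow> _)"
proof -
  have "\<exists>m\<in>S. \<forall>s\<in>S. \<not> strict_prefix s m" if "S \<noteq> {}" for S :: "nat list set"
    using ex_has_least_nat[of "\<lambda>s. s \<in> S" _ length] that
    by (metis ex_in_conv leD prefix_length_less)
  moreover have "strict_prefix a b \<or> strict_prefix b a"
    if "strict_prefix a x" "strict_prefix b x" "a \<noteq> b" for a b x :: "nat list"
    using that prefix_same_cases[of a x b] by (auto simp: strict_prefix_def)
  ultimately show ?thesis
    unfolding is_tree_def Let_def by auto
qed

lemma (in pi_scheme) has_pi_tree: "has_pi_tree X"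
proof -
  have "omega_tree UNIV (strict_prefix :: nat list \<Rightarrow> _)"
    unfolding omega_tree_def by (rule exI[of _ id]) auto
  moreover have "locally_strict UNIV strict_prefix L"
    unfolding locally_strict_def sons_list
  proof (intro ballI impI conjI)
    show "L x = (\<Union>s\<in>range (\<lambda>k. x @ [k]). L s)" for x
      using split[of x] by simp
    show "L t \<inter> L u = {}"
      if tu: "t \<in> range (\<lambda>k. x @ [k])" "u \<in> range (\<lambda>k. x @ [k])" "t \<noteq> u" for x t u
    proof -
      obtain i j where "t = x @ [i]" "u = x @ [j]" using tu by blast
      then show ?thesis using disj[of i j x] \<open>t \<noteq> u\<close> by blast
    qed
  qed
  moreover have "strict_branches UNIV strict_prefix L"
    unfolding strict_branches_def
  proof (intro conjI allI impI)
    fix B :: "nat list set" assume "is_branch UNIV strict_prefix B"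
    then obtain \<alpha> where "B = range (\<lambda>n. map \<alpha> [0..<n])" by (rule branch_list)
    then show "\<exists>p. fruit L B = {p}" using branch[of \<alpha>] by (simp add: fruit_def)
  qed simp
  moreover have "\<exists>r\<in>UNIV. (\<forall>x\<in>UNIV. x \<noteq> r \<longrightarrow> strict_prefix r x) \<and> L r = topspace X"
    by (rule bexI[of _ "[]"]) (auto simp: root strict_prefix_def)
  moreover have "grows_into X UNIV strict_prefix L"
    unfolding grows_into_def
  proof (intro ballI allI impI)
    fix p U assume "U \<subseteq> topspace X \<and> (\<exists>V. openin X V \<and> p \<in> V \<and> V \<subseteq> U)"
    then obtain V where V: "openin X V" "p \<in> V" "V \<subseteq> U" by blast
    then obtain s where s: "p \<in> L s" "finite {k. \<not> L (s @ [k]) \<subseteq> V}"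
      using grow by blast
    \<comment> \<open>The witness for the shoot: all sons whose leaves lie in
      \<open>V\<close>.\<close>
    define C where "C = (\<lambda>k. s @ [k]) ` {k. L (s @ [k]) \<subseteq> V}"
    have "range (\<lambda>k. s @ [k]) - C \<subseteq> (\<lambda>k. s @ [k]) ` {k. \<not> L (s @ [k]) \<subseteq> V}"
      by (auto simp: C_def)
    then have "finite (range (\<lambda>k. s @ [k]) - C)"
      using s(2) finite_surj by blast
    moreover have "C \<subseteq> range (\<lambda>k. s @ [k])" by (auto simp: C_def)
    ultimately have "(\<Union>t\<in>C. L t) \<in> shoot UNIV strict_prefix L s"
      unfolding shoot_def sons_list by blast
    moreover have "(\<Union>t\<in>C. L t) \<subseteq> U" using V(3) by (auto simp: C_def)
    moreover have "(\<Union>t\<in>C. L t) \<noteq> {}"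
    proof -
      obtain k where "L (s @ [k]) \<subseteq> V"
        using s(2) infinite_UNIV_nat by (metis (mono_tags, lifting) UNIV_eq_I mem_Collect_eq)
      then show ?thesis using L_nonempty[of "s @ [k]"] by (auto simp: C_def)
    qed
    ultimately have "\<exists>G\<in>shoot UNIV strict_prefix L s. G \<noteq> {} \<and> G \<subseteq> U"
      by (intro bexI conjI)
    then have "refines (shoot UNIV strict_prefix L s) {U}"
      by (simp add: refines_def)
    then show "\<exists>z\<in>scope UNIV L p. refines (shoot UNIV strict_prefix L z) {U}"
      using s(1) by (auto simp: scope_def)
  qed
  ultimately show ?thesis
    unfolding has_pi_tree_def pi_tree_def baire_foliage_tree_def foliage_open_in_def
    using is_tree_list open_L by blast
qed

lemma has_pi_tree_imp_scheme:
  assumes "has_pi_tree X"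
  obtains L where "pi_scheme X L"
proof -
  obtain Q :: "nat list set" and lt l where pt: "pi_tree X Q lt l"
    using assms unfolding has_pi_tree_def by blast
  then obtain f :: "nat list \<Rightarrow> nat list" where f: "bij_betw f Q UNIV"
    and lt: "\<And>x y. x \<in> Q \<Longrightarrow> y \<in> Q \<Longrightarrow> lt x y \<longleftrightarrow> strict_prefix (f x) (f y)"
    unfolding pi_tree_def baire_foliage_tree_def omega_tree_def by blast
  \<comment> \<open>The inverse isomorphism; composing the leaves with it indexes the tree by all of
    \<open>nat list\<close>.\<close>
  define g where "g = inv_into Q f"
  have g: "bij_betw g UNIV Q" using f by (simp add: g_def bij_betw_inv_into)
  have gQ: "g s \<in> Q" for s using g by (auto simp: bij_betw_def)
  have fg: "f (g s) = s" for s
    using f by (metis UNIV_I bij_betw_inv_into_right g_def)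
  have gf: "g (f x) = x" if "x \<in> Q" for x
    using f that by (metis bij_betw_inv_into_left g_def)
  have g_inj: "inj g" using g by (simp add: bij_betw_def)
  have ltg: "lt (g s) (g t) \<longleftrightarrow> strict_prefix s t" for s t
    using lt gQ fg by metis
  have Qg: "Q = range g" using g by (auto simp: bij_betw_def)
  have sons: "sons Q lt (g s) = range (\<lambda>k. g (s @ [k]))" for s
  proof -
    have "sons Q lt (g s) = g ` sons UNIV strict_prefix s"
      unfolding sons_def Qg using ltg by auto
    then show ?thesis by (simp add: sons_list image_image)
  qed
  \<comment> \<open>Maximality is transferred by pulling a larger chain in \<open>Q\<close> back
    along \<open>f\<close>.\<close>
  have branch_image: "is_branch Q lt (g ` B)" if B: "is_branch UNIV strict_prefix B" for B
    unfolding is_branch_def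
  proof (intro conjI allI impI)
    show "is_chain Q lt (g ` B)"
      using B gQ ltg g_inj unfolding is_branch_def is_chain_def by (auto simp: inj_eq)
    fix C assume C: "is_chain Q lt C \<and> g ` B \<subseteq> C"
    then have CQ: "C \<subseteq> Q" by (simp add: is_chain_def)
    have "is_chain UNIV strict_prefix (f ` C)"
      using C lt unfolding is_chain_def by (auto simp: subset_iff) metis
    moreover have "B \<subseteq> f ` C" using C fg by (metis image_subset_iff image_eqI subsetI)
    ultimately have "f ` C = B" using B unfolding is_branch_def by blast
    then show "C = g ` B" using CQ gf by (force simp: image_image)
  qed
  have "pi_scheme X (\<lambda>s. l (g s))"
  proof
    obtain r where r: "r \<in> Q" "\<And>x. x \<in> Q \<Longrightarrow> x \<noteq> r \<Longrightarrow> lt r x" "l r = topspace X"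
      using pt unfolding pi_tree_def baire_foliage_tree_def by blast
    have "g [] = r"
    proof (rule ccontr)
      assume "g [] \<noteq> r"
      then have "strict_prefix (f r) []" using r gQ lt fg by metis
      then show False by simp
    qed
    then show "l (g []) = topspace X" using r by simp
  next
    fix s
    have "\<exists>y\<in>Q. lt (g s) y"
      by (rule bexI[of _ "g (s @ [0])"]) (auto simp: ltg gQ strict_prefix_def)
    then have ls: "l (g s) = (\<Union>t\<in>sons Q lt (g s). l t)"
      "\<And>t u. t \<in> sons Q lt (g s) \<Longrightarrow> u \<in> sons Q lt (g s) \<Longrightarrow> t \<noteq> u \<Longrightarrow> l t \<inter> l u = {}"
      using pt gQ[of s] unfolding pi_tree_def baire_foliage_tree_def locally_strict_def
      by blast+
    show "l (g s) = (\<Union>k. l (g (s @ [k])))"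
      using ls(1) unfolding sons by simp
    show "l (g (s @ [i])) \<inter> l (g (s @ [j])) = {}" if "i \<noteq> j" for i j
      using ls(2)[of "g (s @ [i])" "g (s @ [j])"] that g_inj unfolding sons by (auto simp: inj_eq)
    show "openin X (l (g s))"
      using pt gQ unfolding pi_tree_def baire_foliage_tree_def foliage_open_in_def by blast
  next
    fix \<alpha> :: "nat \<Rightarrow> nat"
    have "is_branch Q lt (g ` range (\<lambda>n. map \<alpha> [0..<n]))"
      by (rule branch_image[OF branch_of_sequence])
    then show "\<exists>p. (\<Inter>n. l (g (map \<alpha> [0..<n]))) = {p}"
      using pt unfolding pi_tree_def baire_foliage_tree_def strict_branches_def fruit_def
      by (auto simp: image_image)
  next
    fix V p assume V: "openin X V" "p \<in> V"
    then have "V \<subseteq> topspace X" by (simp add: openin_subset)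
    then obtain z where z: "z \<in> scope Q l p" "refines (shoot Q lt l z) {V}"
      using pt V unfolding pi_tree_def grows_into_def by (meson order_refl subsetD)
    then obtain s where s: "z = g s" by (auto simp: scope_def Qg)
    obtain C where C: "finite (sons Q lt z - C)" "(\<Union>t\<in>C. l t) \<subseteq> V"
      using z(2) V(2) unfolding refines_def shoot_def by blast
    have "(\<lambda>k. g (s @ [k])) ` {k. \<not> l (g (s @ [k])) \<subseteq> V} \<subseteq> sons Q lt z - C"
      using C(2) unfolding s sons by auto
    moreover have "inj (\<lambda>k. g (s @ [k]))" using g_inj by (auto simp: inj_def)
    ultimately have "finite {k. \<not> l (g (s @ [k])) \<subseteq> V}"
      using C(1) by (meson finite_imageD finite_subset inj_on_subset subset_UNIV)
    then show "\<exists>s. p \<in> l (g s) \<and> finite {k. \<not> l (g (s @ [k])) \<subseteq> V}"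
      using z(1) s by (auto simp: scope_def)
  qed
  then show thesis by (rule that)
qed

section \<open>Removing countably many compact sets\<close>

text \<open>\<open>Cell s j\<close> stands for \<open>L s - F\<close>, where \<open>K 0, \<dots>, K (j - 1)\<close> already miss \<open>L s\<close>.
  \<open>Pass s j t m\<close> stands for the points of \<open>L t - F\<close> whose exit from the tree of \<open>K j\<close> above \<open>s\<close>
  has colour \<open>m\<close>.\<close>
datatype state =
  Cell "nat list" nat
| Pass "nat list" nat "nat list" nat

primrec addr :: "state \<Rightarrow> nat list" where
  "addr (Cell s j) = s"
| "addr (Pass s j t m) = t"

locale pi_scheme_minus = pi_scheme +
  fixes K :: "nat \<Rightarrow> 'a set"
  assumes compact_K: "compactin X (K j)"
begin

definition Y :: "'a set" where
  "Y = topspace X - (\<Union>j. K j)"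

text \<open>Only nodes above \<open>s\<close> matter; \<open>s\<close> itself is included so that every point of \<open>L s - K j\<close> has
  an exit even if \<open>L s\<close> misses \<open>K j\<close>.\<close>
definition W :: "nat list \<Rightarrow> nat \<Rightarrow> nat list \<Rightarrow> bool" where
  "W s j t \<longleftrightarrow> t = s \<or> L t \<inter> K j \<noteq> {}"

text \<open>The colour of the exit \<open>t @ [k]\<close> is the height of \<open>t\<close> above
  \<open>s\<close> plus a first pairing coordinate. That coordinate takes every value infinitely
  often, so exactly the colours from the height upwards occur, each for infinitely many
  \<open>k\<close>.\<close>

definition colour :: "nat list \<Rightarrow> nat list \<Rightarrow> nat \<Rightarrow> nat" where
  "colour s t k = length t - length s + fst (prod_decode k)"

text \<open>The sons of \<open>t\<close> through which an exit of colour \<open>m\<close> can be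
  reached: exits of that colour, and sons in the tree whose own height is at most \<open>m\<close>.
  The height bound is what forces the descent to end.\<close>

definition M :: "nat list \<Rightarrow> nat \<Rightarrow> nat list \<Rightarrow> nat \<Rightarrow> nat set" where
  "M s j t m = {k. if W s j (t @ [k]) then length t < length s + m else colour s t k = m}"

lemma mem_M: "k \<in> M s j t m \<longleftrightarrow>
    (if W s j (t @ [k]) then length t < length s + m else colour s t k = m)"
  by (simp add: M_def)

primrec leaf :: "state \<Rightarrow> 'a set" where
  "leaf (Cell s j) = Y \<inter> L s"
| "leaf (Pass s j t m) = Y \<inter> \<Union> {L (u @ [k]) | u k.
     prefix t u \<and> W s j u \<and> \<not> W s j (u @ [k]) \<and> colour s u k = m}"

text \<open>Only the sons in \<open>M\<close> are kept; \<open>enumerate\<close> renumbers them by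
  all naturals, so that the new skeleton is again the full tree.\<close>

primrec step :: "state \<Rightarrow> nat \<Rightarrow> state" where
  "step (Cell s j) m = Pass s j s m"
| "step (Pass s j t m) i = (let u = t @ [enumerate (M s j t m) i]
     in if W s j u then Pass s j u m else Cell u (Suc j))"

text \<open>The invariant of reachable states. The height bound on \<open>t\<close> ensures that
  colour \<open>m\<close> still occurs among the numbers \<open>k\<close> at
  \<open>t\<close>.\<close>

primrec valid :: "state \<Rightarrow> bool" where
  "valid (Cell s j) \<longleftrightarrow> (\<forall>i<j. L s \<inter> K i = {})"
| "valid (Pass s j t m) \<longleftrightarrow>
     (\<forall>i<j. L s \<inter> K i = {}) \<and> prefix s t \<and> W s j t \<and> length t \<le> length s + m"

lemma infinite_M:
  assumes "valid (Pass s j t m)"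
  shows "infinite (M s j t m)"
proof -
  \<comment> \<open>The first coordinate that yields colour exactly \<open>m\<close> at
    \<open>t\<close>; all \<open>prod_encode (d, i)\<close> have it, and only finitely many of them
    stay in the tree.\<close>
  define d where "d = m - (length t - length s)"
  have len: "length t - length s + d = m" "length s \<le> length t"
    using assms prefix_length_le[of s t] by (auto simp: d_def)
  have "inj (\<lambda>i. prod_encode (d, i))" by (auto intro: injI)
  then have "infinite (range (\<lambda>i. prod_encode (d, i)))"
    using finite_imageD by blast
  moreover have "W s j (t @ [k]) \<longleftrightarrow> L (t @ [k]) \<inter> K j \<noteq> {}" for k
    using len(2) by (auto simp: W_def)
  then have "finite {k. W s j (t @ [k])}"
    using compact_finitely_branching[OF compact_K] by simp
  ultimately have "infinite (range (\<lambda>i. prod_encode (d, i)) - {k. W s j (t @ [k])})"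
    by (rule Diff_infinite_finite[rotated])
  moreover have "range (\<lambda>i. prod_encode (d, i)) - {k. W s j (t @ [k])} \<subseteq> M s j t m"
    using len(1) by (auto simp: mem_M colour_def split: if_splits)
  ultimately show ?thesis using finite_subset by blast
qed

lemma range_step_Pass:
  assumes "valid (Pass s j t m)"
  shows "range (step (Pass s j t m)) = (\<lambda>k. if W s j (t @ [k]) then Pass s j (t @ [k]) m
    else Cell (t @ [k]) (Suc j)) ` M s j t m"
  using range_enumerate[OF infinite_M[OF assms]] by (force simp: Let_def image_iff)

text \<open>After an exit, \<open>K j\<close> is missed by definition of \<open>W\<close>, and the
  earlier compact sets are missed because the new leaf lies in \<open>L s\<close>. Inside the tree,
  membership in \<open>M\<close> gives the height bound.\<close>

lemma valid_step:
  assumes "valid z"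
  shows "valid (step z i)"
proof (cases z)
  case (Cell s j)
  then show ?thesis using assms by (simp add: W_def)
next
  case (Pass s j t m)
  let ?k = "enumerate (M s j t m) i"
  have k: "?k \<in> M s j t m"
    using enumerate_in_set[OF infinite_M] assms Pass by blast
  have st: "prefix s t" "prefix t (t @ [?k])" and old: "\<forall>i<j. L s \<inter> K i = {}"
    using assms Pass by auto
  have "L (t @ [?k]) \<inter> K h = {}" if h: "h < Suc j" and W: "\<not> W s j (t @ [?k])" for h
  proof (cases "h = j")
    case False
    then have "L s \<inter> K h = {}" using h old by simp
    then show ?thesis using L_mono[OF prefix_order.trans[OF st]] by blast
  qed (use W in \<open>simp add: W_def\<close>)
  then show ?thesis using assms k[unfolded mem_M] Pass by (auto simp: Let_def)
qed

section \<open>Exits from the tree of one compact set\<close>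

lemma exit_unique:
  assumes "p \<in> L (u @ [k])" "prefix s u" "W s j u" "\<not> W s j (u @ [k])"
    and "p \<in> L (v @ [i])" "prefix s v" "W s j v" "\<not> W s j (v @ [i])"
  shows "u @ [k] = v @ [i]"
proof -
  \<comment> \<open>If an exit were a proper prefix of another, it would lie at or below
    \<open>c\<close>, the last tree node before the latter. But \<open>c\<close> is longer than
    \<open>s\<close>, so \<open>L c\<close> meets \<open>K j\<close>, and then so does the leaf of
    the shorter exit.\<close>
  have *: "a @ [b] = c @ [d]"
    if "prefix (a @ [b]) (c @ [d])" "prefix s a" "W s j c" "\<not> W s j (a @ [b])" for a b c d
  proof (rule ccontr)
    assume "a @ [b] \<noteq> c @ [d]"
    then have "prefix (a @ [b]) c" using that(1) by (metis prefix_snoc)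
    then have "c \<noteq> s"
      using that(2) prefix_length_le by (metis length_append_singleton not_less_eq_eq order_trans)
    moreover have "L c \<subseteq> L (a @ [b])" using \<open>prefix (a @ [b]) c\<close> by (rule L_mono)
    ultimately show False using that(3,4) by (auto simp: W_def)
  qed
  show ?thesis
    using comparable[OF assms(1,5)] *[of u k v i] *[of v i u k] assms by metis
qed

text \<open>By \<open>compact_escape\<close> the tree nodes around \<open>p\<close> have bounded
  length; the longest one is followed by the exit.\<close>

lemma exit_exists:
  assumes "p \<in> Y" "p \<in> L s"
  obtains u k where "p \<in> L (u @ [k])" "prefix s u" "W s j u" "\<not> W s j (u @ [k])"
proof -
  have p: "p \<in> topspace X" "p \<notin> K j" using assms by (auto simp: Y_def)
  let ?P = "\<lambda>n. \<exists>u. length u = n \<and> prefix s u \<and> p \<in> L u \<and> W s j u"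
  obtain n where n: "\<And>u. p \<in> L u \<Longrightarrow> n \<le> length u \<Longrightarrow> L u \<inter> K j = {}"
    using compact_escape[OF compact_K p] by metis
  have start: "?P (length s)" using assms by (auto simp: W_def)
  have bound: "l \<le> n + length s" if "?P l" for l
  proof (rule ccontr)
    assume l: "\<not> l \<le> n + length s"
    obtain u where u: "length u = l" "p \<in> L u" "W s j u" using \<open>?P l\<close> by blast
    then have "u \<noteq> s" "n \<le> length u" using l by auto
    then show False using n u by (auto simp: W_def)
  qed
  define l where "l = Greatest ?P"
  have l: "?P l"
    unfolding l_def by (rule GreatestI_nat[of ?P, OF start bound])
  have l_max: "l' \<le> l" if "?P l'" for l'
    unfolding l_def by (rule Greatest_le_nat[of ?P, OF that bound])
  from l obtain u where u: "length u = l" "prefix s u" "p \<in> L u" "W s j u" by blast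
  then obtain k where k: "p \<in> L (u @ [k])" using split by blast
  have "\<not> W s j (u @ [k])"
  proof
    assume "W s j (u @ [k])"
    then have "?P (Suc l)"
      using u k by (intro exI[of _ "u @ [k]"]) auto
    then show False using l_max[of "Suc l"] by simp
  qed
  then show thesis using that k u by blast
qed

lemma leaf_addr: "leaf z \<subseteq> Y \<inter> L (addr z)"
proof (cases z)
  case (Pass s j t m)
  have "L (u @ [k]) \<subseteq> L t" if "prefix t u" for u k
    using that by (intro L_mono) (rule prefix_prefix)
  then show ?thesis using Pass by fastforce
qed simp

text \<open>At a \<open>Cell\<close>, points are sorted by the colour of their exit. At a
  \<open>Pass\<close>, the exit either is a son of \<open>t\<close> or lies above a son that is
  still in the tree.\<close>

lemma leaf_split:
  assumes "valid z"
  shows "leaf z = (\<Union>i. leaf (step z i))"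
proof (cases z)
  case (Cell s j)
  have "Y \<inter> L s \<subseteq> (\<Union>m. leaf (Pass s j s m))"
  proof
    fix p assume p: "p \<in> Y \<inter> L s"
    then obtain u k where "p \<in> L (u @ [k])" "prefix s u" "W s j u" "\<not> W s j (u @ [k])"
      using exit_exists by blast
    then have "p \<in> leaf (Pass s j s (colour s u k))" using p by auto
    then show "p \<in> (\<Union>m. leaf (Pass s j s m))" by blast
  qed
  moreover have "leaf (Pass s j s m) \<subseteq> Y \<inter> L s" for m
    using leaf_addr[of "Pass s j s m"] by simp
  ultimately show ?thesis unfolding Cell leaf.simps(1) step.simps(1) by blast
next
  case (Pass s j t m)
  let ?son = "\<lambda>k. if W s j (t @ [k]) then Pass s j (t @ [k]) m else Cell (t @ [k]) (Suc j)"
  have val: "prefix s t" "W s j t" "length t \<le> length s + m" using assms Pass by auto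
  have "leaf z = (\<Union>k\<in>M s j t m. leaf (?son k))"
  proof (intro equalityI subsetI)
    fix p assume "p \<in> leaf z"
    then obtain u k where p: "p \<in> Y" "p \<in> L (u @ [k])" and u: "prefix t u" "W s j u"
      "\<not> W s j (u @ [k])" "colour s u k = m" using Pass by auto
    show "p \<in> (\<Union>k\<in>M s j t m. leaf (?son k))"
    proof (cases "u = t")
      case True
      then have "k \<in> M s j t m" "p \<in> leaf (?son k)" using p u by (auto simp: mem_M)
      then show ?thesis by blast
    next
      case False
      then obtain i v where v: "u = t @ i # v"
        using u(1) by (metis append_Nil2 neq_Nil_conv prefixE)
      then have "prefix (t @ [i]) u" by simp
      \<comment> \<open>\<open>u\<close> is longer than \<open>s\<close>, so \<open>L u\<close>
        meets \<open>K j\<close>, and so does the larger leaf of the son on the way to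
        \<open>u\<close>.\<close>
      then have "W s j (t @ [i])"
        using u(2) val(1) v L_mono[of "t @ [i]" u] prefix_length_le[of s t] by (auto simp: W_def)
      \<comment> \<open>The colour \<open>m\<close> is at least the height of \<open>u\<close>,
        which exceeds that of \<open>t\<close>.\<close>
      moreover have "length t < length s + m"
        using u(4) v prefix_length_le[OF val(1)] by (auto simp: colour_def)
      moreover have "p \<in> leaf (Pass s j (t @ [i]) m)"
        using p u \<open>prefix (t @ [i]) u\<close> by auto
      ultimately have "i \<in> M s j t m" "p \<in> leaf (?son i)" by (auto simp: mem_M)
      then show ?thesis by blast
    qed
  next
    fix p assume "p \<in> (\<Union>k\<in>M s j t m. leaf (?son k))"
    then obtain k where k: "k \<in> M s j t m" "p \<in> leaf (?son k)" by blast
    show "p \<in> leaf z"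
    proof (cases "W s j (t @ [k])")
      case True
      then obtain u i where "p \<in> Y" "p \<in> L (u @ [i])" "prefix (t @ [k]) u" "W s j u"
        "\<not> W s j (u @ [i])" "colour s u i = m" using k(2) by auto
      moreover from this have "prefix t u" by (metis append_prefixD)
      ultimately show ?thesis using Pass by auto
    next
      case False
      then show ?thesis using k Pass val by (auto simp: mem_M)
    qed
  qed
  also have "\<dots> = \<Union> (leaf ` range (step z))"
    unfolding Pass range_step_Pass[OF assms[unfolded Pass]] image_image ..
  finally show ?thesis by simp
qed

text \<open>Below a \<open>Cell\<close> the reason is that a point has only one exit, hence one
  colour; below a \<open>Pass\<close> the addresses are distinct siblings.\<close>

lemma leaf_disjoint:
  assumes "valid z" "i \<noteq> j"
  shows "leaf (step z i) \<inter> leaf (step z j) = {}"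
proof (cases z)
  case (Cell s h)
  show ?thesis
  proof (rule ccontr)
    assume "\<not> ?thesis"
    then obtain p where p: "p \<in> leaf (Pass s h s i)" "p \<in> leaf (Pass s h s j)"
      using Cell by auto
    obtain u k where u: "p \<in> L (u @ [k])" "prefix s u" "W s h u" "\<not> W s h (u @ [k])"
      "colour s u k = i" using p(1) by auto
    obtain v l where v: "p \<in> L (v @ [l])" "prefix s v" "W s h v" "\<not> W s h (v @ [l])"
      "colour s v l = j" using p(2) by auto
    show False using exit_unique[OF u(1-4) v(1-4)] u(5) v(5) assms(2) by simp
  qed
next
  case (Pass s h t m)
  have "addr (step z i) = t @ [enumerate (M s h t m) i]" for i
    using Pass by (simp add: Let_def)
  moreover have "enumerate (M s h t m) i \<noteq> enumerate (M s h t m) j"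
    using infinite_M assms Pass enumerate_mono by (metis less_irrefl linorder_neqE_nat)
  ultimately have "L (addr (step z i)) \<inter> L (addr (step z j)) = {}"
    by (simp add: disj)
  then show ?thesis
    using leaf_addr[of "step z i"] leaf_addr[of "step z j"] by blast
qed

section \<open>The new scheme: leaves, openness and growth\<close>

definition run :: "nat list \<Rightarrow> state" where
  "run \<sigma> = foldl step (Cell [] 0) \<sigma>"

lemma run_simps [simp]: "run [] = Cell [] 0" "run (\<sigma> @ [i]) = step (run \<sigma>) i"
  by (simp_all add: run_def)

lemma valid_run: "valid (run \<sigma>)"
  by (induction \<sigma> rule: rev_induct) (auto simp: valid_step)

lemma openin_leaf: "openin (subtopology X Y) (leaf z)"
proof -
  have "openin X (\<Union> {L (u @ [k]) | u k. P u k})" for P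
    using open_L by (intro openin_Union) auto
  then show ?thesis
    using open_L by (cases z) (auto intro!: openin_subtopology_Int2)
qed

text \<open>Following \<open>p\<close> through the new tree skips no old node on its way. This is
  needed for growth, since it is at a \<open>Pass\<close> over \<open>u\<close> that the new sons
  sit in distinct old sons of \<open>u\<close>.\<close>

lemma Pass_over:
  assumes "p \<in> Y" "p \<in> L u"
  shows "\<exists>\<sigma> s j m. run \<sigma> = Pass s j u m \<and> p \<in> leaf (run \<sigma>)"
  using assms(2)
proof (induction u rule: rev_induct)
  \<comment> \<open>A \<open>Cell\<close> over \<open>u\<close> is followed by a \<open>Pass\<close>
    over the same \<open>u\<close>.\<close>
  have cell: "\<exists>\<sigma> s j m. run \<sigma> = Pass s j u m \<and> p \<in> leaf (run \<sigma>)"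
    if run: "run \<sigma> = Cell u j" and p: "p \<in> leaf (run \<sigma>)" for \<sigma> u j
  proof -
    obtain m where "p \<in> leaf (step (run \<sigma>) m)"
      using leaf_split[OF valid_run] p by blast
    then have "p \<in> leaf (run (\<sigma> @ [m]))" by simp
    moreover have "run (\<sigma> @ [m]) = Pass u j u m" using run by simp
    ultimately show ?thesis by blast
  qed
  {
    case Nil
    then show ?case using assms(1) by (intro cell[of "[]" _ 0]) auto
  next
    case (snoc k u)
    have "p \<in> L u" using snoc.prems split[of u] by blast
    then obtain \<sigma> s j m where \<sigma>: "run \<sigma> = Pass s j u m" "p \<in> leaf (run \<sigma>)"
      using snoc.IH by blast
    obtain i where i: "p \<in> leaf (step (run \<sigma>) i)"
      using leaf_split[OF valid_run] \<sigma>(2) by blast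
    let ?k = "enumerate (M s j u m) i"
    have "addr (step (run \<sigma>) i) = u @ [?k]" using \<sigma>(1) by (simp add: Let_def)
    then have "?k = k"
      using leaf_addr[of "step (run \<sigma>) i"] i disj[of ?k k u] snoc.prems by auto
    then have "run (\<sigma> @ [i]) =
        (if W s j (u @ [k]) then Pass s j (u @ [k]) m else Cell (u @ [k]) (Suc j))"
      using \<sigma>(1) by (simp add: Let_def)
    then show ?case using i cell[of "\<sigma> @ [i]" "u @ [k]"] by (metis run_simps(2))
  }
qed

lemma run_grow:
  assumes "openin (subtopology X Y) U" "p \<in> U"
  shows "\<exists>\<sigma>. p \<in> leaf (run \<sigma>) \<and> finite {i. \<not> leaf (run (\<sigma> @ [i])) \<subseteq> U}"
proof -
  obtain V where V: "openin X V" "U = V \<inter> Y"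
    using assms(1) by (auto simp: openin_subtopology)
  then obtain u where u: "p \<in> L u" "finite {k. \<not> L (u @ [k]) \<subseteq> V}"
    using grow assms(2) by blast
  obtain \<sigma> s j m where \<sigma>: "run \<sigma> = Pass s j u m" "p \<in> leaf (run \<sigma>)"
    using Pass_over u(1) V(2) assms(2) by blast
  let ?e = "enumerate (M s j u m)"
  have "leaf (run (\<sigma> @ [i])) \<subseteq> Y \<inter> L (u @ [?e i])" for i
    using leaf_addr[of "run (\<sigma> @ [i])"] \<sigma>(1) by (simp add: Let_def split: if_splits)
  then have "{i. \<not> leaf (run (\<sigma> @ [i])) \<subseteq> U} \<subseteq> ?e -` {k. \<not> L (u @ [k]) \<subseteq> V}"
    using V(2) by blast
  \<comment> \<open>Injectivity keeps the preimage of the finite exceptional set finite.\<close>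
  moreover have "inj ?e"
    using infinite_M valid_run[of \<sigma>] \<sigma>(1) strict_mono_enumerate strict_mono_imp_inj_on by metis
  ultimately show ?thesis
    using \<sigma>(2) finite_vimageI[OF u(2)] finite_subset by blast
qed

section \<open>Infinite branches of the new tree\<close>

context
  fixes \<alpha> :: "nat \<Rightarrow> nat"
begin

definition path :: "nat \<Rightarrow> state" where
  "path n = run (map \<alpha> [0..<n])"

lemma path_Suc: "path (Suc n) = step (path n) (\<alpha> n)"
  by (simp add: path_def)

lemma valid_path: "valid (path n)"
  by (simp add: path_def valid_run)

lemma addr_path_mono: "m \<le> n \<Longrightarrow> prefix (addr (path m)) (addr (path n))"
proof (induction rule: dec_induct)
  case (step n)
  have "prefix (addr z) (addr (step z i))" for z i
    by (cases z) (auto simp: Let_def)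
  then show ?case using step prefix_order.trans by (metis path_Suc)
qed simp

lemma leaf_path_antimono: "m \<le> n \<Longrightarrow> leaf (path n) \<subseteq> leaf (path m)"
proof (induction rule: dec_induct)
  case (step n)
  then show ?case using leaf_split[OF valid_path[of n]] path_Suc by auto
qed simp

lemma addr_path_unbounded: "\<exists>n. N < length (addr (path n))"
proof (induction N)
  \<comment> \<open>Leaving a \<open>Cell\<close> keeps the address, but the \<open>Pass\<close>
    reached then lengthens it; hence two steps.\<close>
  have grow: "length (addr (path n)) < length (addr (path (Suc (Suc n))))" for n
    by (cases "path n") (auto simp: path_Suc Let_def)
  {
    case 0
    then show ?case using grow by (metis gr0I less_zeroE not_gr0)
  next
    case (Suc N)
    then show ?case using grow by (meson Suc_lessI less_trans_Suc)
  }
qed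

text \<open>Each step inside the tree uses up one of the levels left below height \<open>m\<close>,
  and \<open>M\<close> contains no tree node once none is left.\<close>

lemma path_leaves_Pass:
  assumes "path n = Pass s j t m"
  shows "\<exists>n'\<ge>n. \<exists>s'. path n' = Cell s' (Suc j)"
  using assms
proof (induction "length s + m - length t" arbitrary: n t rule: less_induct)
  case less
  let ?k = "enumerate (M s j t m) (\<alpha> n)"
  have val: "valid (Pass s j t m)" using valid_path[of n] less.prems by simp
  show ?case
  proof (cases "W s j (t @ [?k])")
    case True
    then have "path (Suc n) = Pass s j (t @ [?k]) m"
      using less.prems by (simp add: path_Suc)
    moreover have "length t < length s + m"
      using enumerate_in_set[OF infinite_M[OF val], of "\<alpha> n"] True
      by (simp only: mem_M if_True)
    moreover from this have "length s + m - length (t @ [?k]) < length s + m - length t" by simp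
    ultimately have "\<exists>n'\<ge>Suc n. \<exists>s'. path n' = Cell s' (Suc j)"
      by (intro less.hyps)
    then show ?thesis by (meson Suc_leD)
  next
    case False
    then have "path (Suc n) = Cell (t @ [?k]) (Suc j)"
      using less.prems by (simp add: path_Suc)
    then show ?thesis by (meson le_SucI order_refl)
  qed
qed

lemma path_reaches_Cell: "\<exists>n s. path n = Cell s j"
proof (induction j)
  case 0
  have "path 0 = Cell [] 0" by (simp add: path_def)
  then show ?case by blast
next
  case (Suc j)
  then obtain n s where "path n = Cell s j" by blast
  then have "path (Suc n) = Pass s j s (\<alpha> n)" by (simp add: path_Suc)
  then show ?case using path_leaves_Pass by blast
qed

lemma path_limit: "\<exists>p. (\<Inter>n. leaf (path n)) = {p}"
proof -
  let ?B = "range (\<lambda>n. addr (path n))"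
  have chain: "prefix \<sigma> \<tau> \<or> prefix \<tau> \<sigma>" if B: "\<sigma> \<in> ?B" "\<tau> \<in> ?B" for \<sigma> \<tau>
  proof -
    obtain m n where "\<sigma> = addr (path m)" "\<tau> = addr (path n)" using B by blast
    then show ?thesis using addr_path_mono[of m n] addr_path_mono[of n m] by fastforce
  qed
  have unb: "\<exists>\<sigma>\<in>?B. n < length \<sigma>" for n
    using addr_path_unbounded by blast
  obtain \<beta> where \<beta>: "\<And>\<sigma>. \<sigma> \<in> ?B \<Longrightarrow> \<sigma> = map \<beta> [0..<length \<sigma>]"
    using chain_limit[of ?B, OF chain unb] by blast
  \<comment> \<open>The candidate is the fruit of the old branch traced by the addresses.\<close>
  obtain x where x: "(\<Inter>n. L (map \<beta> [0..<n])) = {x}" using branch by blast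
  have x_addr: "x \<in> L (addr (path n))" for n
    using x \<beta>[of "addr (path n)"] by (metis INT_E UNIV_I insertI1 rangeI)
  \<comment> \<open>A valid \<open>Cell\<close> of index \<open>Suc j\<close> has a leaf address
    that misses \<open>K j\<close>.\<close>
  have "x \<notin> K j" for j
  proof -
    obtain n s where "path n = Cell s (Suc j)" using path_reaches_Cell by blast
    then have "L s \<inter> K j = {}" "x \<in> L s"
      using valid_path[of n] x_addr[of n] by auto
    then show ?thesis by blast
  qed
  moreover have "x \<in> topspace X" using x_addr[of 0] openin_subset[OF open_L] by blast
  ultimately have xY: "x \<in> Y" by (simp add: Y_def)
  \<comment> \<open>Membership is clear at a \<open>Cell\<close>, whose leaf is all of
    \<open>Y \<inter> L s\<close>; a later \<open>Cell\<close> always exists, and leaves decrease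
    along the path.\<close>
  have x_leaf: "x \<in> leaf (path n)" for n
  proof -
    have "\<exists>n'\<ge>n. \<exists>s j. path n' = Cell s j"
      using path_leaves_Pass by (cases "path n") blast+
    then obtain n' s j where n': "n' \<ge> n" "path n' = Cell s j" by blast
    then have "x \<in> leaf (path n')" using xY x_addr[of n'] by simp
    then show ?thesis using leaf_path_antimono[OF n'(1)] by blast
  qed
  have "q = x" if q: "\<And>n. q \<in> leaf (path n)" for q
  proof -
    have "q \<in> L (map \<beta> [0..<k])" for k
    proof -
      obtain n where n: "k < length (addr (path n))" using addr_path_unbounded by blast
      have "prefix (map \<beta> [0..<k]) (addr (path n))"
        using \<beta>[of "addr (path n)"] n by (metis less_imp_le prefix_map_upt rangeI)
      then show ?thesis using L_mono leaf_addr[of "path n"] q[of n] by blast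
    qed
    then show ?thesis using x by blast
  qed
  then have "(\<Inter>n. leaf (path n)) = {x}" using x_leaf by blast
  then show ?thesis ..
qed

end

lemma scheme_minus: "pi_scheme (subtopology X Y) (\<lambda>\<sigma>. leaf (run \<sigma>))"
proof
  show "leaf (run []) = topspace (subtopology X Y)"
    by (auto simp: root Y_def)
  show "\<exists>p. (\<Inter>n. leaf (run (map \<alpha> [0..<n]))) = {p}" for \<alpha>
    using path_limit[of \<alpha>] by (simp add: path_def)
  show "leaf (run \<sigma>) = (\<Union>k. leaf (run (\<sigma> @ [k])))" for \<sigma>
    unfolding run_simps(2) by (rule leaf_split[OF valid_run])
  show "leaf (run (\<sigma> @ [i])) \<inter> leaf (run (\<sigma> @ [j])) = {}" if "i \<noteq> j" for i j \<sigma>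
    unfolding run_simps(2) using that by (rule leaf_disjoint[OF valid_run])
  show "openin (subtopology X Y) (leaf (run \<sigma>))" for \<sigma>
    by (rule openin_leaf)
  show "\<exists>\<sigma>. p \<in> leaf (run \<sigma>) \<and> finite {i. \<not> leaf (run (\<sigma> @ [i])) \<subseteq> U}"
    if "openin (subtopology X Y) U" "p \<in> U" for U p
    using that by (rule run_grow)
qed

end

theorem mainTheorem1:
  fixes X :: "'a topology" and F :: "'a set"
  assumes "has_pi_tree X"
    and "sigma_compact_in X F"
  shows "has_pi_tree (subtopology X (topspace X - F))"
proof -
  obtain L where L: "pi_scheme X L" using assms(1) by (rule has_pi_tree_imp_scheme)
  obtain K :: "nat \<Rightarrow> 'a set" where K: "\<And>n. compactin X (K n)" "F = (\<Union>n. K n)"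
    using assms(2) unfolding sigma_compact_in_def by blast
  interpret pi_scheme_minus X L K
    using L K(1) by (simp add: pi_scheme_minus_def pi_scheme_minus_axioms_def)
  show ?thesis
    using pi_scheme.has_pi_tree[OF scheme_minus] unfolding Y_def K(2) .
qed

end
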